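(* There is an absolute constant $c>0$ such that for every $\kappa\ge1$ and every deterministic online algorithm $ALG$ for (unconstrained, $K=\mathbb{R}^d$) convex function chasing, there exist a dimension $d$, a starting point, and a finite sequence of $\kappa$-well-conditioned request functions on $\mathbb{R}^d$ on which the cost of $ALG$ is at least $c\,\kappa^{1/3}\cdot OPT$. That is, every algorithm for chasing convex functions with condition number at most $\kappa$ has competitive ratio $\Omega(\kappa^{1/3})$.
   Context: Convex function chasing in Euclidean space: a starting point $x_0\in\mathbb{R}^d$ is fixed; non-negative convex differentiable functions $f_1,\dots,f_T:\mathbb{R}^d\to[0,\infty)$ arrive one at a time, and after seeing $f_t$ (and only $f_1,\dots,f_t$) the online algorithm chooses $x_t\in\mathbb{R}^d$. The cost of $X=(x_1,\dots,x_T)$ is $\sum_{t=1}^T(\|x_t-x_{t-1}\|_2+f_t(x_t))$; $OPT$ is the infimum of this cost over all offline sequences with $y_0=x_0$. The competitive ratio of an algorithm is the supremum over instances of its cost divided by $OPT$. A differentiable $f$ is $\alpha$-strongly convex if $f(y)-f(x)-\langle\nabla f(x),y-x\rangle\ge\frac{\alpha}{2}\|x-y\|_2^2$ for all $x,y$, and $\beta$-smooth if the same quantity is $\le\frac{\beta}{2}\|x-y\|_2^2$; $f$ is $\kappa$-well-conditioned if it is $\alpha$-strongly convex and $\alpha\kappa$-smooth for some $\alpha>0$. *)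

theory Defs
  imports
    "HOL-Library.Extended_Real"
    "HOL-Library.FuncSet"
    "Jordan_Normal_Form.Matrix"
begin

text \<open>
  The dimension is chosen after the algorithm, so it has to be a bound variable:
  \<open>\<real>\<^sup>d\<close> is rendered as \<^term>\<open>carrier_vec d :: real vec set\<close>.
  Request functions are extensional, hence a term \<open>f\<close> with \<open>request d f\<close> is
  exactly a function \<open>\<real>\<^sup>d \<rightarrow> [0,\<infinity>)\<close>, with no extra information outside \<open>\<real>\<^sup>d\<close>.
\<close>

type_synonym func = "real vec \<Rightarrow> real"

definition norm2 :: "real vec \<Rightarrow> real" where
  "norm2 x = sqrt (x \<bullet> x)"

text \<open>Frechet differentiability on \<open>\<real>\<^sup>d\<close>, the derivative being \<open>h \<mapsto> \<langle>g, h\<rangle>\<close>.\<close>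

definition has_gradient :: "nat \<Rightarrow> func \<Rightarrow> real vec \<Rightarrow> real vec \<Rightarrow> bool" where
  "has_gradient d f g x \<longleftrightarrow> g \<in> carrier_vec d \<and>
     (\<forall>\<epsilon>>0. \<exists>\<delta>>0. \<forall>y\<in>carrier_vec d. norm2 (y - x) < \<delta> \<longrightarrow>
        \<bar>f y - f x - g \<bullet> (y - x)\<bar> \<le> \<epsilon> * norm2 (y - x))"

definition differentiable_fun :: "nat \<Rightarrow> func \<Rightarrow> bool" where
  "differentiable_fun d f \<longleftrightarrow> (\<forall>x\<in>carrier_vec d. \<exists>g. has_gradient d f g x)"

definition gradient :: "nat \<Rightarrow> func \<Rightarrow> real vec \<Rightarrow> real vec" where
  "gradient d f x = (THE g. has_gradient d f g x)"

definition convex_fun :: "nat \<Rightarrow> func \<Rightarrow> bool" where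
  "convex_fun d f \<longleftrightarrow> (\<forall>x\<in>carrier_vec d. \<forall>y\<in>carrier_vec d. \<forall>u\<in>{0..1}.
     f ((1 - u) \<cdot>\<^sub>v x + u \<cdot>\<^sub>v y) \<le> (1 - u) * f x + u * f y)"

definition strongly_convex :: "nat \<Rightarrow> real \<Rightarrow> func \<Rightarrow> bool" where
  "strongly_convex d \<alpha> f \<longleftrightarrow> differentiable_fun d f \<and>
     (\<forall>x\<in>carrier_vec d. \<forall>y\<in>carrier_vec d.
        f y - f x - gradient d f x \<bullet> (y - x) \<ge> \<alpha> / 2 * (norm2 (x - y))\<^sup>2)"

definition smooth_fun :: "nat \<Rightarrow> real \<Rightarrow> func \<Rightarrow> bool" where
  "smooth_fun d \<beta> f \<longleftrightarrow> differentiable_fun d f \<and>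
     (\<forall>x\<in>carrier_vec d. \<forall>y\<in>carrier_vec d.
        f y - f x - gradient d f x \<bullet> (y - x) \<le> \<beta> / 2 * (norm2 (x - y))\<^sup>2)"

definition well_conditioned :: "nat \<Rightarrow> real \<Rightarrow> func \<Rightarrow> bool" where
  "well_conditioned d \<kappa> f \<longleftrightarrow> (\<exists>\<alpha>>0. strongly_convex d \<alpha> f \<and> smooth_fun d (\<alpha> * \<kappa>) f)"

definition request :: "nat \<Rightarrow> func \<Rightarrow> bool" where
  "request d f \<longleftrightarrow> f \<in> carrier_vec d \<rightarrow>\<^sub>E {0..} \<and> convex_fun d f \<and> differentiable_fun d f"

text \<open>
  The request \<open>f\<^sub>t\<close> is \<open>fs ! (t - 1)\<close>; a solution is a sequence \<open>X\<close> with \<open>X 0\<close> the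
  starting point, of which only the entries up to \<^term>\<open>length fs\<close> matter.
\<close>

definition cost :: "func list \<Rightarrow> (nat \<Rightarrow> real vec) \<Rightarrow> real" where
  "cost fs X = (\<Sum>t=1..length fs. norm2 (X t - X (t - 1)) + (fs ! (t - 1)) (X t))"

definition OPT :: "nat \<Rightarrow> real vec \<Rightarrow> func list \<Rightarrow> real" where
  "OPT d x0 fs =
     Inf {cost fs Y | Y. Y 0 = x0 \<and> (\<forall>t\<in>{1..length fs}. Y t \<in> carrier_vec d)}"

text \<open>
  A deterministic online algorithm maps the starting point (whose \<^term>\<open>dim_vec\<close>
  reveals the dimension) and the requests \<open>[f\<^sub>1, \<dots>, f\<^sub>t]\<close> seen so far to \<open>x\<^sub>t\<close>. Its own
  earlier positions are determined by these data and need not be passed.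
\<close>

type_synonym alg = "real vec \<Rightarrow> func list \<Rightarrow> real vec"

definition online_algorithm :: "alg \<Rightarrow> bool" where
  "online_algorithm A \<longleftrightarrow> (\<forall>d x0 fs. 0 < d \<longrightarrow> x0 \<in> carrier_vec d \<longrightarrow> fs \<noteq> [] \<longrightarrow>
     (\<forall>f\<in>set fs. request d f) \<longrightarrow> A x0 fs \<in> carrier_vec d)"

definition trajectory :: "alg \<Rightarrow> real vec \<Rightarrow> func list \<Rightarrow> nat \<Rightarrow> real vec" where
  "trajectory A x0 fs t = (if t = 0 then x0 else A x0 (take t fs))"

definition alg_cost :: "alg \<Rightarrow> real vec \<Rightarrow> func list \<Rightarrow> real" where
  "alg_cost A x0 fs = cost fs (trajectory A x0 fs)"

definition wc_instance :: "real \<Rightarrow> nat \<Rightarrow> real vec \<Rightarrow> func list \<Rightarrow> bool" where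
  "wc_instance \<kappa> d x0 fs \<longleftrightarrow> 0 < d \<and> x0 \<in> carrier_vec d \<and>
     (\<forall>f\<in>set fs. request d f \<and> well_conditioned d \<kappa> f)"

text \<open>
  Division is that of \<^typ>\<open>ereal\<close>: an instance with \<open>OPT = 0\<close> contributes \<open>\<infinity>\<close> if the
  algorithm has positive cost, and \<open>0 / 0 = 0\<close>.
\<close>

definition competitive_ratio :: "real \<Rightarrow> alg \<Rightarrow> ereal" where
  "competitive_ratio \<kappa> A =
     Sup {ereal (alg_cost A x0 fs) / ereal (OPT d x0 fs) | d x0 fs. wc_instance \<kappa> d x0 fs}"

lemma norm2_nonneg: "norm2 x \<ge> 0"
  unfolding norm2_def scalar_prod_def by (simp add: sum_nonneg)

lemma norm2_smult: "norm2 (c \<cdot>\<^sub>v x) = \<bar>c\<bar> * norm2 x"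
proof -
  have "(c \<cdot>\<^sub>v x) \<bullet> (c \<cdot>\<^sub>v x) = c\<^sup>2 * (x \<bullet> x)"
    by (simp add: scalar_prod_def sum_distrib_left power2_eq_square algebra_simps)
  thus ?thesis by (simp add: norm2_def real_sqrt_mult)
qed

lemma has_gradient_unique:
  assumes g: "has_gradient d f g x" and g': "has_gradient d f g' x"
    and x: "x \<in> carrier_vec d"
  shows "g = g'"
proof -
  define h where "h = g - g'"
  have gc: "g \<in> carrier_vec d" "g' \<in> carrier_vec d"
    using g g' by (auto simp: has_gradient_def)
  have hc: "h \<in> carrier_vec d" using gc by (simp add: h_def)
  have hh: "h \<bullet> h \<ge> 0" by (simp add: scalar_prod_def sum_nonneg)
  have le: "norm2 h \<le> 2 * e" if e: "e > 0" for e
  proof (cases "norm2 h = 0")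
    case False
    hence n: "norm2 h > 0" using norm2_nonneg[of h] by linarith
    obtain d1 where d1: "d1 > 0" "\<And>y. y \<in> carrier_vec d \<Longrightarrow> norm2 (y - x) < d1 \<Longrightarrow>
        \<bar>f y - f x - g \<bullet> (y - x)\<bar> \<le> e * norm2 (y - x)"
      using g e unfolding has_gradient_def by blast
    obtain d2 where d2: "d2 > 0" "\<And>y. y \<in> carrier_vec d \<Longrightarrow> norm2 (y - x) < d2 \<Longrightarrow>
        \<bar>f y - f x - g' \<bullet> (y - x)\<bar> \<le> e * norm2 (y - x)"
      using g' e unfolding has_gradient_def by blast
    define t where "t = min d1 d2 / 2 / norm2 h"
    have t: "t > 0" using n d1 d2 by (simp add: t_def)
    have tn: "t * norm2 h < d1" "t * norm2 h < d2" using n d1 d2 by (auto simp: t_def min_def)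
    define y where "y = x + t \<cdot>\<^sub>v h"
    have yc: "y \<in> carrier_vec d" using x hc by (simp add: y_def)
    have yx: "y - x = t \<cdot>\<^sub>v h" using x hc by (auto simp: y_def intro!: eq_vecI)
    have ny: "norm2 (y - x) = t * norm2 h" using t by (simp add: yx norm2_smult)
    have "\<bar>g \<bullet> (y - x) - g' \<bullet> (y - x)\<bar> \<le> 2 * e * (t * norm2 h)"
      using d1(2)[OF yc] d2(2)[OF yc] tn unfolding ny by linarith
    moreover have "g \<bullet> (y - x) - g' \<bullet> (y - x) = t * (norm2 h)\<^sup>2"
    proof -
      have "g \<bullet> (y - x) - g' \<bullet> (y - x) = h \<bullet> (t \<cdot>\<^sub>v h)"
        unfolding yx h_def using gc hc minus_scalar_prod_distrib[of g d g' "t \<cdot>\<^sub>v h"]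
        by (simp add: h_def)
      also have "\<dots> = t * (h \<bullet> h)" using hc by simp
      finally show ?thesis using hh by (simp add: norm2_def)
    qed
    ultimately have "(t * norm2 h) * norm2 h \<le> (t * norm2 h) * (2 * e)"
      using t by (simp add: power2_eq_square algebra_simps)
    thus ?thesis using t n by simp
  qed (use e in simp)
  have "norm2 h \<le> 0"
    by (rule field_le_epsilon) (use le[of "_ / 2"] in auto)
  hence "h \<bullet> h = 0" using norm2_nonneg[of h] by (simp add: norm2_def)
  hence "\<forall>i<d. h $ i = 0"
    using hc by (simp add: scalar_prod_def sum_nonneg_eq_0_iff)
  thus ?thesis using gc by (auto simp: h_def intro!: eq_vecI)
qed

lemma gradient_eq:
  assumes "has_gradient d f g x" and "x \<in> carrier_vec d"
  shows "gradient d f x = g"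
  unfolding gradient_def using assms has_gradient_unique by blast

end

theory Submission
  imports Defs
begin

text \<open>
  Start at the origin. Request \<open>t\<close> is
  \<open>f\<^sub>t(x) = (1/2)((x\<^sub>t - s\<^sub>t)\<^sup>2 + (1/\<kappa>) \<Sum>\<^bsub>i\<noteq>t\<^esub> x\<^sub>i\<^sup>2)\<close>, where the sign \<open>s\<^sub>t = \<plusminus>1\<close> is chosen
  opposite to the \<open>t\<close>-th coordinate of the algorithm's current position. Whether the
  algorithm moves in this coordinate or not, it pays at least \<open>1/2\<close> for the request,
  so \<open>d\<close> requests cost it at least \<open>d/2\<close>. Moving once to \<open>(s\<^sub>1, \<dots>, s\<^sub>d)\<close> costs only
  \<open>\<surd>d + d\<^sup>2/(2\<kappa>)\<close>. The two terms balance at \<open>d \<approx> \<kappa>\<^bsup>2/3\<^esup>\<close>, and the ratio is of order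
  \<open>\<surd>d = \<kappa>\<^bsup>1/3\<^esup>\<close>.
\<close>

section \<open>Separable quadratic requests\<close>

lemma norm2_square: "(norm2 x)\<^sup>2 = (\<Sum>i<dim_vec x. (x $ i)\<^sup>2)"
  by (simp add: norm2_def scalar_prod_def sum_nonneg power2_eq_square atLeast0LessThan)

lemma norm2_ge_coord:
  assumes "i < dim_vec x"
  shows "\<bar>x $ i\<bar> \<le> norm2 x"
proof (rule power2_le_imp_le[OF _ norm2_nonneg])
  have "(x $ i)\<^sup>2 \<le> (\<Sum>i<dim_vec x. (x $ i)\<^sup>2)"
    by (rule member_le_sum) (use assms in auto)
  thus "\<bar>x $ i\<bar>\<^sup>2 \<le> (norm2 x)\<^sup>2" by (simp add: norm2_square)
qed

lemma norm2_minus_swap: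
  assumes "x \<in> carrier_vec d" and "y \<in> carrier_vec d"
  shows "norm2 (x - y) = norm2 (y - x)"
proof (rule power2_eq_imp_eq[OF _ norm2_nonneg norm2_nonneg])
  show "(norm2 (x - y))\<^sup>2 = (norm2 (y - x))\<^sup>2"
    using assms by (auto simp: norm2_square power2_commute intro!: sum.cong)
qed

text \<open>The restricted lambda makes the function extensional, as \<open>request\<close>
  demands.\<close>

definition quad :: "nat \<Rightarrow> (nat \<Rightarrow> real) \<Rightarrow> (nat \<Rightarrow> real) \<Rightarrow> func" where
  "quad d w c = (\<lambda>x\<in>carrier_vec d. 1 / 2 * (\<Sum>i<d. w i * (x $ i - c i)\<^sup>2))"

definition quad_grad :: "nat \<Rightarrow> (nat \<Rightarrow> real) \<Rightarrow> (nat \<Rightarrow> real) \<Rightarrow> real vec \<Rightarrow> real vec" where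
  "quad_grad d w c x = vec d (\<lambda>i. w i * (x $ i - c i))"

text \<open>A quadratic equals its second-order expansion exactly, so the remainder is independent
  of \<open>c\<close>. Strong convexity, smoothness and differentiability can then all be read off
  the weights \<open>w\<close>.\<close>

lemma quad_bregman:
  assumes "x \<in> carrier_vec d" and "y \<in> carrier_vec d"
  shows "quad d w c y - quad d w c x - quad_grad d w c x \<bullet> (y - x) =
    1 / 2 * (\<Sum>i<d. w i * ((y - x) $ i)\<^sup>2)"
proof -
  have "quad_grad d w c x \<bullet> (y - x) = (\<Sum>i<d. w i * (x $ i - c i) * (y $ i - x $ i))"
    using assms by (auto simp: quad_grad_def scalar_prod_def atLeast0LessThan intro!: sum.cong)
  moreover have "(\<Sum>i<d. w i * ((y - x) $ i)\<^sup>2) = (\<Sum>i<d. w i * (y $ i - x $ i)\<^sup>2)"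
    using assms by (auto intro!: sum.cong)
  ultimately show ?thesis using assms
    by (simp add: quad_def sum_distrib_left flip: sum_subtractf)
      (auto intro!: sum.cong simp: field_simps power2_eq_square)
qed

lemma quad_bregman_bounds:
  assumes x: "x \<in> carrier_vec d" and y: "y \<in> carrier_vec d"
    and w: "\<And>i. i < d \<Longrightarrow> a \<le> w i \<and> w i \<le> b"
  shows "a / 2 * (norm2 (y - x))\<^sup>2 \<le>
      quad d w c y - quad d w c x - quad_grad d w c x \<bullet> (y - x)"
    and "quad d w c y - quad d w c x - quad_grad d w c x \<bullet> (y - x) \<le>
      b / 2 * (norm2 (y - x))\<^sup>2"
proof -
  have dim: "dim_vec (y - x) = d" using x by simp
  show "a / 2 * (norm2 (y - x))\<^sup>2 \<le>
      quad d w c y - quad d w c x - quad_grad d w c x \<bullet> (y - x)"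
    unfolding quad_bregman[OF x y] norm2_square dim sum_distrib_left
    by (intro sum_mono) (use w in \<open>auto intro!: mult_right_mono\<close>)
  show "quad d w c y - quad d w c x - quad_grad d w c x \<bullet> (y - x) \<le>
      b / 2 * (norm2 (y - x))\<^sup>2"
    unfolding quad_bregman[OF x y] norm2_square dim sum_distrib_left
    by (intro sum_mono) (use w in \<open>auto intro!: mult_right_mono\<close>)
qed

lemma quad_has_gradient:
  assumes x: "x \<in> carrier_vec d" and w: "\<And>i. i < d \<Longrightarrow> 0 \<le> w i \<and> w i \<le> b" and b: "0 < b"
  shows "has_gradient d (quad d w c) (quad_grad d w c x) x"
  unfolding has_gradient_def
proof (intro conjI allI impI)
  show "quad_grad d w c x \<in> carrier_vec d" by (simp add: quad_grad_def)
  fix e :: real assume e: "e > 0"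
  \<comment> \<open>The remainder lies between 0 and b/2 times the squared distance, so the radius
    \<open>e / b\<close> makes it at most e/2 times the distance.\<close>
  have "\<bar>quad d w c y - quad d w c x - quad_grad d w c x \<bullet> (y - x)\<bar> \<le> e * norm2 (y - x)"
    if y: "y \<in> carrier_vec d" and n: "norm2 (y - x) < e / b" for y
  proof -
    have "\<bar>quad d w c y - quad d w c x - quad_grad d w c x \<bullet> (y - x)\<bar> \<le> b / 2 * (norm2 (y - x))\<^sup>2"
      using quad_bregman_bounds[where w = w and c = c and a = 0 and b = b, OF x y] w by simp
    also have "\<dots> = (b * norm2 (y - x)) / 2 * norm2 (y - x)" by (simp add: power2_eq_square)
    also have "\<dots> \<le> e * norm2 (y - x)"
    proof (rule mult_right_mono[OF _ norm2_nonneg])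
      have "b * norm2 (y - x) \<le> e" using n b by (simp add: field_simps)
      thus "b * norm2 (y - x) / 2 \<le> e" using e by linarith
    qed
    finally show ?thesis .
  qed
  thus "\<exists>\<delta>>0. \<forall>y\<in>carrier_vec d. norm2 (y - x) < \<delta> \<longrightarrow>
      \<bar>quad d w c y - quad d w c x - quad_grad d w c x \<bullet> (y - x)\<bar> \<le> e * norm2 (y - x)"
    using e b by (intro exI[of _ "e / b"]) simp
qed

lemma quad_convex:
  assumes w: "\<And>i. i < d \<Longrightarrow> 0 \<le> w i"
  shows "convex_fun d (quad d w c)"
  unfolding convex_fun_def
proof (intro ballI)
  fix x y :: "real vec" and u :: real
  assume x: "x \<in> carrier_vec d" and y: "y \<in> carrier_vec d" and u: "u \<in> {0..1}"
  have sq: "((1 - u) * p + u * q - r)\<^sup>2 \<le> (1 - u) * (p - r)\<^sup>2 + u * (q - r)\<^sup>2" for p q r :: real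
  proof -
    have "(1 - u) * (p - r)\<^sup>2 + u * (q - r)\<^sup>2 - ((1 - u) * p + u * q - r)\<^sup>2
        = u * (1 - u) * (p - q)\<^sup>2"
      by (simp add: power2_eq_square algebra_simps)
    moreover have "u * (1 - u) * (p - q)\<^sup>2 \<ge> 0" using u by simp
    ultimately show ?thesis by linarith
  qed
  have "(\<Sum>i<d. w i * (((1 - u) \<cdot>\<^sub>v x + u \<cdot>\<^sub>v y) $ i - c i)\<^sup>2)
      \<le> (\<Sum>i<d. (1 - u) * (w i * (x $ i - c i)\<^sup>2) + u * (w i * (y $ i - c i)\<^sup>2))"
  proof (rule sum_mono)
    fix i assume i: "i \<in> {..<d}"
    have "w i * ((1 - u) * x $ i + u * y $ i - c i)\<^sup>2
        \<le> w i * ((1 - u) * (x $ i - c i)\<^sup>2 + u * (y $ i - c i)\<^sup>2)"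
      by (rule mult_left_mono[OF sq]) (use w i in auto)
    thus "w i * (((1 - u) \<cdot>\<^sub>v x + u \<cdot>\<^sub>v y) $ i - c i)\<^sup>2
        \<le> (1 - u) * (w i * (x $ i - c i)\<^sup>2) + u * (w i * (y $ i - c i)\<^sup>2)"
      using x y i by (simp add: algebra_simps)
  qed
  thus "quad d w c ((1 - u) \<cdot>\<^sub>v x + u \<cdot>\<^sub>v y) \<le> (1 - u) * quad d w c x + u * quad d w c y"
    using x y by (simp add: quad_def sum.distrib flip: sum_distrib_left)
qed

lemma quad_request:
  assumes w: "\<And>i. i < d \<Longrightarrow> 0 \<le> w i \<and> w i \<le> b" and b: "0 < b"
  shows "request d (quad d w c)"
  unfolding request_def
proof (intro conjI)
  show "quad d w c \<in> carrier_vec d \<rightarrow>\<^sub>E {0..}"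
    using w by (auto simp: quad_def intro!: sum_nonneg)
  show "convex_fun d (quad d w c)" using w by (intro quad_convex) blast
  show "differentiable_fun d (quad d w c)"
    unfolding differentiable_fun_def using quad_has_gradient[where w = w and b = b] w b by blast
qed

lemma quad_well_conditioned:
  assumes a: "0 < a" and \<kappa>: "0 < \<kappa>" and w: "\<And>i. i < d \<Longrightarrow> a \<le> w i \<and> w i \<le> a * \<kappa>"
  shows "well_conditioned d \<kappa> (quad d w c)"
proof -
  have w0: "0 \<le> w i \<and> w i \<le> a * \<kappa>" if "i < d" for i
    using w[OF that] a by linarith
  have grad: "has_gradient d (quad d w c) (quad_grad d w c x) x" if "x \<in> carrier_vec d" for x
    using quad_has_gradient[where w = w and b = "a * \<kappa>", OF that] w0 a \<kappa> by simp
  have diff: "differentiable_fun d (quad d w c)"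
    unfolding differentiable_fun_def using grad by blast
  have bounds: "a / 2 * (norm2 (x - y))\<^sup>2 \<le>
        quad d w c y - quad d w c x - gradient d (quad d w c) x \<bullet> (y - x) \<and>
      quad d w c y - quad d w c x - gradient d (quad d w c) x \<bullet> (y - x) \<le>
        a * \<kappa> / 2 * (norm2 (x - y))\<^sup>2"
    if x: "x \<in> carrier_vec d" and y: "y \<in> carrier_vec d" for x y
    unfolding gradient_eq[OF grad[OF x] x] norm2_minus_swap[OF x y]
    using quad_bregman_bounds[where w = w and c = c and a = a and b = "a * \<kappa>", OF x y] w by blast
  have "strongly_convex d a (quad d w c)" "smooth_fun d (a * \<kappa>) (quad d w c)"
    unfolding strongly_convex_def smooth_fun_def using diff bounds by blast+
  thus ?thesis unfolding well_conditioned_def using a by blast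
qed

section \<open>The adversary\<close>

definition spike :: "real \<Rightarrow> nat \<Rightarrow> nat \<Rightarrow> real \<Rightarrow> func" where
  "spike \<kappa> d n s = quad d (\<lambda>i. if i = n then 1 else 1 / \<kappa>) (\<lambda>i. if i = n then s else 0)"

lemma spike_request:
  assumes "\<kappa> \<ge> 1"
  shows "request d (spike \<kappa> d n s)" and "well_conditioned d \<kappa> (spike \<kappa> d n s)"
  unfolding spike_def
  \<comment> \<open>The weights are 1/\<kappa> and 1, that is, a and a\<kappa> for a =
    1/\<kappa>.\<close>
  using assms by (auto intro!: quad_request[where b = 1] quad_well_conditioned[where a = "1 / \<kappa>"])

lemma spike_nonneg:
  assumes "\<kappa> \<ge> 1" and "x \<in> carrier_vec d"
  shows "0 \<le> spike \<kappa> d n s x"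
  using spike_request(1)[OF assms(1), of d n s] assms(2) by (auto simp: request_def PiE_iff)

lemma spike_ge:
  assumes \<kappa>: "\<kappa> \<ge> 1" and x: "x \<in> carrier_vec d" and n: "n < d"
  shows "1 / 2 * (x $ n - s)\<^sup>2 \<le> spike \<kappa> d n s x"
proof -
  let ?g = "\<lambda>i. (if i = n then 1 else 1 / \<kappa>) * (x $ i - (if i = n then s else 0))\<^sup>2"
  have "?g n \<le> (\<Sum>i<d. ?g i)"
    by (rule member_le_sum) (use \<kappa> n in auto)
  thus ?thesis using x by (simp add: spike_def quad_def)
qed

text \<open>If coordinate n ends at distance u from s, the movement costs at least 1 - u and the
  request at least u^2/2. Their sum exceeds 1/2 by (1 - u)^2/2. The bound serves the algorithm at
  every step and every offline solution at the first step.\<close>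

lemma spike_step_cost:
  assumes \<kappa>: "\<kappa> \<ge> 1" and x: "x \<in> carrier_vec d" and y: "y \<in> carrier_vec d" and n: "n < d"
    and far: "1 \<le> \<bar>x $ n - s\<bar>"
  shows "1 / 2 \<le> norm2 (y - x) + spike \<kappa> d n s y"
proof -
  define u where "u = \<bar>y $ n - s\<bar>"
  have "\<bar>(y - x) $ n\<bar> \<le> norm2 (y - x)" by (rule norm2_ge_coord) (use n x in simp)
  hence "1 - u \<le> norm2 (y - x)" using far x n unfolding u_def by simp
  moreover have "1 / 2 * u\<^sup>2 \<le> spike \<kappa> d n s y"
    using spike_ge[OF \<kappa> y n, of s] by (simp add: u_def)
  moreover have "0 \<le> (1 - u)\<^sup>2" by simp
  hence "1 / 2 \<le> 1 - u + 1 / 2 * u\<^sup>2" by (simp add: power2_eq_square algebra_simps)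
  ultimately show ?thesis by linarith
qed

text \<open>Unlike \<open>- sgn x\<close>, this is nonzero at 0: the coordinates start there, and
  the target must still be at distance 1.\<close>

definition opposite_sign :: "real \<Rightarrow> real" where
  "opposite_sign x = (if x \<ge> 0 then -1 else 1)"

lemma opposite_sign_far: "1 \<le> \<bar>x - opposite_sign x\<bar>"
  by (simp add: opposite_sign_def)

text \<open>The adversary simulates the deterministic algorithm: the request with index n, counted
  from 0, reacts to the position reached after the first n requests, and for n = 0 this is the
  origin.\<close>

primrec adversary :: "real \<Rightarrow> nat \<Rightarrow> alg \<Rightarrow> nat \<Rightarrow> func list" where
  "adversary \<kappa> d A 0 = []"
| "adversary \<kappa> d A (Suc n) = adversary \<kappa> d A n @
     [spike \<kappa> d n (opposite_sign (trajectory A (0\<^sub>v d) (adversary \<kappa> d A n) n $ n))]"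

definition adv_sign :: "real \<Rightarrow> nat \<Rightarrow> alg \<Rightarrow> nat \<Rightarrow> real" where
  "adv_sign \<kappa> d A n = opposite_sign (trajectory A (0\<^sub>v d) (adversary \<kappa> d A n) n $ n)"

lemma length_adversary [simp]: "length (adversary \<kappa> d A m) = m"
  by (induction m) auto

lemma take_adversary: "n \<le> m \<Longrightarrow> take n (adversary \<kappa> d A m) = adversary \<kappa> d A n"
proof (induction m)
  case (Suc m)
  thus ?case by (cases "n = Suc m") auto
qed simp

lemma nth_adversary: "n < m \<Longrightarrow> adversary \<kappa> d A m ! n = spike \<kappa> d n (adv_sign \<kappa> d A n)"
proof (induction m)
  case (Suc m)
  thus ?case by (cases "n = m") (auto simp: nth_append adv_sign_def)
qed simp

text \<open>Each sign was chosen against a run on a prefix. Since the lists extend one another and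
  the algorithm sees only prefixes, that position is also the one in the full run.\<close>

lemma trajectory_adversary:
  "n \<le> m \<Longrightarrow> trajectory A x0 (adversary \<kappa> d A m) n = trajectory A x0 (adversary \<kappa> d A n) n"
  by (simp add: trajectory_def take_adversary)

lemma adversary_instance:
  assumes "\<kappa> \<ge> 1" and "0 < d"
  shows "wc_instance \<kappa> d (0\<^sub>v d) (adversary \<kappa> d A m)"
  using assms spike_request[OF assms(1)]
  by (auto simp: wc_instance_def in_set_conv_nth nth_adversary)

lemma trajectory_carrier:
  assumes "online_algorithm A" and "0 < d" and "x0 \<in> carrier_vec d"
    and "\<forall>f\<in>set fs. request d f" and "fs \<noteq> []"
  shows "trajectory A x0 fs t \<in> carrier_vec d"
proof (cases t)
  case (Suc k)
  have "\<forall>f\<in>set (take t fs). request d f" using assms(4) by (meson in_set_takeD)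
  moreover have "take t fs \<noteq> []" using Suc assms(5) by simp
  ultimately show ?thesis using assms Suc by (simp add: trajectory_def online_algorithm_def)
qed (simp add: trajectory_def assms(3))

section \<open>Lower bound on the cost of the algorithm\<close>

lemma adversary_alg_cost:
  assumes \<kappa>: "\<kappa> \<ge> 1" and d: "0 < d" and A: "online_algorithm A"
  shows "real d / 2 \<le> alg_cost A (0\<^sub>v d) (adversary \<kappa> d A d)"
proof -
  let ?fs = "adversary \<kappa> d A d" and ?X = "trajectory A (0\<^sub>v d) (adversary \<kappa> d A d)"
  have ne: "?fs \<noteq> []" using d length_adversary[of \<kappa> d A d] by fastforce
  have X: "?X t \<in> carrier_vec d" for t
    using adversary_instance[OF \<kappa> d, of A d]
    by (intro trajectory_carrier[OF A d _ _ ne]) (auto simp: wc_instance_def)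
  have "1 / 2 \<le> norm2 (?X t - ?X (t - 1)) + (?fs ! (t - 1)) (?X t)" if t: "t \<in> {1..d}" for t
  proof -
    \<comment> \<open>Request t = n + 1 attacks coordinate n, and the position just before it is
      \<open>?X n\<close>.\<close>
    obtain n where n: "t = Suc n" "n < d" using t by (cases t) auto
    have "1 \<le> \<bar>?X n $ n - adv_sign \<kappa> d A n\<bar>"
      using n by (simp add: adv_sign_def opposite_sign_far trajectory_adversary[of n d])
    from spike_step_cost[OF \<kappa> X X n(2) this] show ?thesis
      using n by (simp add: nth_adversary)
  qed
  hence "(\<Sum>t = 1..d. 1 / 2) \<le> alg_cost A (0\<^sub>v d) ?fs"
    unfolding alg_cost_def cost_def length_adversary by (rule sum_mono)
  thus ?thesis by simp
qed

section \<open>Bounds on the offline optimum\<close>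

lemma OPT_le_cost:
  assumes "\<And>t. t \<in> {1..length fs} \<Longrightarrow> Y t \<in> carrier_vec d" and "\<forall>f\<in>set fs. request d f"
  shows "OPT d (Y 0) fs \<le> cost fs Y"
  unfolding OPT_def
proof (rule cInf_lower)
  \<comment> \<open>An infimum of reals is a lower bound only for sets bounded below; nonnegative
    requests supply the bound 0.\<close>
  show "bdd_below {cost fs Z |Z. Z 0 = Y 0 \<and> (\<forall>t\<in>{1..length fs}. Z t \<in> carrier_vec d)}"
  proof (rule bdd_belowI[of _ 0], clarify)
    fix Z :: "nat \<Rightarrow> real vec"
    assume Z: "\<forall>t\<in>{1..length fs}. Z t \<in> carrier_vec d"
    have "0 \<le> (fs ! (t - 1)) (Z t)" if "t \<in> {1..length fs}" for t
    proof -
      have "fs ! (t - 1) \<in> set fs" using that by (intro nth_mem) auto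
      thus ?thesis using assms(2) Z that by (auto simp: request_def PiE_iff)
    qed
    thus "0 \<le> cost fs Z" unfolding cost_def by (intro sum_nonneg add_nonneg_nonneg norm2_nonneg)
  qed
qed (use assms in blast)

text \<open>Every offline solution also starts at distance 1 from the first target, so its first
  step alone costs 1/2. Positivity keeps the competitive ratio from being a division by
  zero.\<close>

lemma adversary_OPT_pos:
  assumes \<kappa>: "\<kappa> \<ge> 1" and d: "0 < d"
  shows "1 / 2 \<le> OPT d (0\<^sub>v d) (adversary \<kappa> d A d)"
  unfolding OPT_def
proof (rule cInf_greatest)
  show "{cost (adversary \<kappa> d A d) Y |Y. Y 0 = 0\<^sub>v d \<and>
      (\<forall>t\<in>{1..length (adversary \<kappa> d A d)}. Y t \<in> carrier_vec d)} \<noteq> {}"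
    by (auto intro!: exI[of _ "\<lambda>_. 0\<^sub>v d"])
next
  fix z assume "z \<in> {cost (adversary \<kappa> d A d) Y |Y. Y 0 = 0\<^sub>v d \<and>
      (\<forall>t\<in>{1..length (adversary \<kappa> d A d)}. Y t \<in> carrier_vec d)}"
  then obtain Y where z: "z = cost (adversary \<kappa> d A d) Y" and Y0: "Y 0 = 0\<^sub>v d"
    and Y: "\<And>t. t \<in> {1..d} \<Longrightarrow> Y t \<in> carrier_vec d" by auto
  let ?g = "\<lambda>t. norm2 (Y t - Y (t - 1)) + (adversary \<kappa> d A d ! (t - 1)) (Y t)"
  have "1 / 2 \<le> norm2 (Y 1 - 0\<^sub>v d) + spike \<kappa> d 0 (adv_sign \<kappa> d A 0) (Y 1)"
    by (rule spike_step_cost) (use \<kappa> d Y in \<open>auto simp: adv_sign_def opposite_sign_def\<close>)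
  hence "1 / 2 \<le> ?g 1" using d by (simp add: Y0 nth_adversary)
  also have "\<dots> \<le> (\<Sum>t = 1..d. ?g t)"
  proof (rule member_le_sum)
    fix t assume "t \<in> {1..d} - {1}"
    thus "0 \<le> ?g t"
      using Y by (auto simp: nth_adversary intro!: add_nonneg_nonneg norm2_nonneg spike_nonneg[OF \<kappa>])
  qed (use d in auto)
  finally show "1 / 2 \<le> z" by (simp add: z cost_def)
qed

lemma adversary_OPT_le:
  assumes \<kappa>: "\<kappa> \<ge> 1" and d: "0 < d"
  shows "OPT d (0\<^sub>v d) (adversary \<kappa> d A d) \<le> sqrt d + (real d)\<^sup>2 / (2 * \<kappa>)"
proof -
  define p where "p = vec d (adv_sign \<kappa> d A)"
  define Y where "Y t = (if t = 0 then 0\<^sub>v d else p)" for t :: nat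
  have p: "p \<in> carrier_vec d" by (simp add: p_def)
  have sq: "(adv_sign \<kappa> d A i)\<^sup>2 = 1" for i by (simp add: adv_sign_def opposite_sign_def)
  have np: "norm2 (p - 0\<^sub>v d) = sqrt d"
  proof (rule power2_eq_imp_eq[OF _ norm2_nonneg])
    show "(norm2 (p - 0\<^sub>v d))\<^sup>2 = (sqrt d)\<^sup>2" by (simp add: norm2_square p_def sq)
  qed simp
  have n0: "norm2 (p - p) = 0"
    by (simp add: norm2_def scalar_prod_def)
  have spike_p: "spike \<kappa> d n (adv_sign \<kappa> d A n) p \<le> real d / (2 * \<kappa>)" for n
  proof -
    \<comment> \<open>The spiked coordinate contributes 0 at \<open>p\<close> and every other one
      1/\<kappa>; the 0 is generously bounded by 1/\<kappa> as well.\<close>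
    have "(\<Sum>i<d. (if i = n then 1 else 1 / \<kappa>) *
        (p $ i - (if i = n then adv_sign \<kappa> d A n else 0))\<^sup>2) \<le> (\<Sum>i<d. 1 / \<kappa>)"
      by (rule sum_mono) (use \<kappa> in \<open>auto simp: p_def sq\<close>)
    thus ?thesis using p by (simp add: spike_def quad_def)
  qed
  have "OPT d (Y 0) (adversary \<kappa> d A d) \<le> cost (adversary \<kappa> d A d) Y"
    by (rule OPT_le_cost)
      (use adversary_instance[OF \<kappa> d, of A d] p in \<open>auto simp: Y_def wc_instance_def\<close>)
  \<comment> \<open>All movement happens before the first request is served; afterwards the solution
    rests at \<open>p\<close>.\<close>
  also have "\<dots> \<le> (\<Sum>t = 1..d. (if t = 1 then sqrt d else 0) + real d / (2 * \<kappa>))"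
    unfolding cost_def length_adversary
  proof (intro sum_mono add_mono)
    fix t assume t: "t \<in> {1..d}"
    show "norm2 (Y t - Y (t - 1)) \<le> (if t = 1 then sqrt d else 0)"
      using t by (auto simp: Y_def np n0)
    show "(adversary \<kappa> d A d ! (t - 1)) (Y t) \<le> real d / (2 * \<kappa>)"
      using t spike_p by (auto simp: Y_def nth_adversary)
  qed
  also have "\<dots> = sqrt d + (real d)\<^sup>2 / (2 * \<kappa>)"
    using d by (simp add: sum.distrib power2_eq_square)
  finally show ?thesis by (simp add: Y_def)
qed

section \<open>Choice of the dimension and the resulting ratio\<close>

text \<open>The dimension is \<kappa>^(2/3) rounded down. Rounding down preserves the upper bound on
  d^2/\<kappa>; since \<kappa> is at least 1, d is at least 1, so \<kappa>^(2/3) < d + 1 \<le> 2d,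
  and rounding costs only the factor 2 under the root.\<close>

lemma balanced_dimension:
  fixes \<kappa> :: real
  assumes \<kappa>: "\<kappa> \<ge> 1"
  obtains d :: nat where "0 < d" and "(real d)\<^sup>2 / \<kappa> \<le> sqrt d" and "\<kappa> powr (1 / 3) \<le> sqrt (2 * d)"
proof -
  define r where "r = \<kappa> powr (1 / 3)"
  define d where "d = nat \<lfloor>r\<^sup>2\<rfloor>"
  have r: "r \<ge> 1" using \<kappa> by (simp add: r_def ge_one_powr_ge_zero)
  have r3: "r ^ 3 = \<kappa>"
    using \<kappa> by (simp add: r_def powr_powr flip: powr_realpow)
  have r2: "r\<^sup>2 \<ge> 1" using r by simp
  have d: "0 < d" unfolding d_def using r2 by linarith
  have dle: "real d \<le> r\<^sup>2" unfolding d_def using r2 by linarith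
  have "r\<^sup>2 < real d + 1" unfolding d_def using r2 by linarith
  hence "r\<^sup>2 \<le> real (2 * d)" using d by simp
  hence low: "\<kappa> powr (1 / 3) \<le> sqrt (2 * d)"
    unfolding r_def[symmetric] by (rule real_le_rsqrt)
  have s: "sqrt d \<le> r" using dle r by (simp add: real_le_lsqrt)
  have "(real d)\<^sup>2 = sqrt d * sqrt d ^ 3" by (simp add: power2_eq_square power3_eq_cube)
  also have "\<dots> \<le> sqrt d * \<kappa>"
    unfolding r3[symmetric] by (intro mult_left_mono power_mono s) auto
  finally have "(real d)\<^sup>2 / \<kappa> \<le> sqrt d" using \<kappa> by (simp add: field_simps)
  from that[OF d this low] show ?thesis .
qed

lemma competitive_ratio_ge:
  assumes "wc_instance \<kappa> d x0 fs" and "OPT d x0 fs > 0"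
    and "r * OPT d x0 fs \<le> alg_cost A x0 fs"
  shows "ereal r \<le> competitive_ratio \<kappa> A"
proof -
  have "ereal r \<le> ereal (alg_cost A x0 fs) / ereal (OPT d x0 fs)"
    using assms(2,3) by (simp add: field_simps)
  also have "\<dots> \<le> competitive_ratio \<kappa> A"
    unfolding competitive_ratio_def by (rule Sup_upper) (use assms(1) in blast)
  finally show ?thesis .
qed

theorem theorem2:
  shows "\<exists>c::real. c > 0 \<and> (\<forall>\<kappa>\<ge>1. \<forall>ALG. online_algorithm ALG \<longrightarrow>
           (\<exists>d x0 fs. wc_instance \<kappa> d x0 fs \<and> OPT d x0 fs > 0 \<and>
              alg_cost ALG x0 fs \<ge> c * \<kappa> powr (1 / 3) * OPT d x0 fs) \<and>
           competitive_ratio \<kappa> ALG \<ge> ereal (c * \<kappa> powr (1 / 3)))"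
proof (intro exI[of _ "1 / 5"] conjI allI impI)
  fix \<kappa> :: real and A :: alg
  assume \<kappa>: "\<kappa> \<ge> 1" and A: "online_algorithm A"
  obtain d :: nat where d: "0 < d" and bal: "(real d)\<^sup>2 / \<kappa> \<le> sqrt d"
    and r: "\<kappa> powr (1 / 3) \<le> sqrt (2 * d)"
    using balanced_dimension[OF \<kappa>] .
  let ?fs = "adversary \<kappa> d A d"
  have inst: "wc_instance \<kappa> d (0\<^sub>v d) ?fs" by (rule adversary_instance[OF \<kappa> d])
  have pos: "OPT d (0\<^sub>v d) ?fs > 0" using adversary_OPT_pos[OF \<kappa> d, of A] by linarith
  \<comment> \<open>The ratio is at least (d/2) / (3/2 sqrt d) = (sqrt d)/3, hence at least
    \<kappa>^(1/3) / (3 sqrt 2). Since 3 sqrt 2 < 5, the constant 1/5 suffices.\<close>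
  have "OPT d (0\<^sub>v d) ?fs \<le> 3 / 2 * sqrt d"
    using adversary_OPT_le[OF \<kappa> d, of A] bal by simp
  hence "1 / 5 * \<kappa> powr (1 / 3) * OPT d (0\<^sub>v d) ?fs \<le> 1 / 5 * sqrt (2 * d) * (3 / 2 * sqrt d)"
    using r pos by (intro mult_mono) auto
  also have "\<dots> = 3 / 10 * sqrt 2 * d" by (simp add: real_sqrt_mult)
  also have "\<dots> \<le> real d / 2"
  proof -
    have "sqrt 2 \<le> 5 / 3" by (rule real_le_lsqrt) (auto simp: power2_eq_square)
    hence "3 / 10 * sqrt 2 * d \<le> 1 / 2 * d" by (intro mult_right_mono) auto
    thus ?thesis by simp
  qed
  also have "\<dots> \<le> alg_cost A (0\<^sub>v d) ?fs" by (rule adversary_alg_cost[OF \<kappa> d A])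
  finally have le: "1 / 5 * \<kappa> powr (1 / 3) * OPT d (0\<^sub>v d) ?fs \<le> alg_cost A (0\<^sub>v d) ?fs" .
  show "\<exists>d x0 fs. wc_instance \<kappa> d x0 fs \<and> OPT d x0 fs > 0 \<and>
      alg_cost A x0 fs \<ge> 1 / 5 * \<kappa> powr (1 / 3) * OPT d x0 fs"
    using inst pos le by blast
  show "competitive_ratio \<kappa> A \<ge> ereal (1 / 5 * \<kappa> powr (1 / 3))"
    by (rule competitive_ratio_ge[OF inst pos le])
qed simp

end
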